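(* Let $n,k$ be integers with $0<k<n$. Let $Y=yy^\top\in\mathbb{S}^{n+1}$ with $y=(t,x)\in\mathbb{R}\times\mathbb{R}^n$. Then $Y\in\mathcal{K}$ if and only if $t=0$ or $\|x\|_0\le k$. In particular, for any $x\in\mathbb{R}^n$, we have $\begin{bmatrix}1 \\ x\end{bmatrix}\begin{bmatrix}1 \\ x\end{bmatrix}^\top\in\mathcal{K}$ if and only if $\|x\|_0\le k$.
   Context: $\mathbb{S}^{n+1}$ is the space of real symmetric $(n+1)\times(n+1)$ matrices. $\|x\|_0$ is the number of nonzero entries of $x$. A matrix $Y\in\mathbb{S}^{n+1}$ is partitioned as $Y=\begin{bmatrix}Y_{11}&Y_{12} \\ Y_{21}&Y_{22}\end{bmatrix}$ with $Y_{11}\in\mathbb{R}$, $Y_{12}=Y_{21}^\top\in\mathbb{R}^{1\times n}$, $Y_{22}\in\mathbb{S}^n$. For a square matrix $M$, $\operatorname{Diag}(M)$ denotes the diagonal matrix with the same diagonal as $M$. The sparsity cone is $$\mathcal{K}=\left\{Y\in\mathbb{S}^{n+1}:\ \mathcal{D}(Y):=\begin{bmatrix}kY_{11}&Y_{12} \\ Y_{21}&\operatorname{Diag}(Y_{22})\end{bmatrix}\succeq0\right\}.$$ *)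

theory Defs
  imports "Jordan_Normal_Form.Matrix"
begin

definition sym_mats :: "nat \<Rightarrow> real mat set" where
  "sym_mats m = {A \<in> carrier_mat m m. transpose_mat A = A}"

(* The library order on matrices is entrywise, so it cannot be used for the Loewner order. *)
definition pos_semidef :: "real mat \<Rightarrow> bool" where
  "pos_semidef A \<longleftrightarrow> A \<in> sym_mats (dim_row A) \<and>
     (\<forall>v \<in> carrier_vec (dim_row A). v \<bullet> (A *\<^sub>v v) \<ge> 0)"

definition zero_norm :: "real vec \<Rightarrow> nat" where
  "zero_norm x = card {i. i < dim_vec x \<and> x $ i \<noteq> 0}"

definition Diag :: "real mat \<Rightarrow> real mat" where
  "Diag M = mat_diag (dim_row M) (\<lambda>i. M $$ (i, i))"

definition sparsity_map :: "nat \<Rightarrow> real mat \<Rightarrow> real mat" where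
  "sparsity_map k Y = (case split_block Y 1 1 of (Y11, Y12, Y21, Y22) \<Rightarrow>
     four_block_mat (of_nat k \<cdot>\<^sub>m Y11) Y12 Y21 (Diag Y22))"

definition sparsity_cone :: "nat \<Rightarrow> nat \<Rightarrow> real mat set" where
  "sparsity_cone n k = {Y \<in> sym_mats (n + 1). pos_semidef (sparsity_map k Y)}"

definition col_mat :: "real vec \<Rightarrow> real mat" where
  "col_mat y = mat_of_cols (dim_vec y) [y]"

definition outer_square :: "real vec \<Rightarrow> real mat" where
  "outer_square y = col_mat y * transpose_mat (col_mat y)"

end

theory Submission
  imports Defs
begin

text \<open>
  Write $v = (s, w)$, $a = t s$ and $u_i = x_i w_i$. The quadratic form of $\mathcal{D}(Y)$ at $v$ is
  $k a^2 + \sum_i (2 a u_i + u_i^2)$, where only the indices in the support of $x$ contribute;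
  completing squares there turns it into $(k - m) a^2 + \sum_i (a + u_i)^2$, where $m$ is
  the support size of $x$. This is nonnegative if $m \le k$ or $a = 0$, and the squares can be made
  to vanish with $a = t$ by taking $w_i = - t / x_i$ on the support.
\<close>

lemma outer_square_carrier: "outer_square y \<in> carrier_mat (dim_vec y) (dim_vec y)"
  by (auto simp: outer_square_def col_mat_def)

lemma outer_square_index:
  assumes "i < dim_vec y" and "j < dim_vec y"
  shows "outer_square y $$ (i, j) = y $ i * y $ j"
  using assms
  by (simp add: outer_square_def col_mat_def scalar_prod_def mat_of_cols_def)

lemma outer_square_sym: "outer_square y \<in> sym_mats (dim_vec y)"
  using outer_square_carrier[of y]
  by (auto simp: sym_mats_def outer_square_index mult.commute intro!: eq_matI)

text \<open>Flattening the blocks to one arrow-shaped matrix lets the quadratic form be expanded by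
  indices. Index 0 carries t and index i + 1 carries \<open>x $ i\<close>; only the corner entry is
  scaled by k.\<close>

lemma sparsity_map_outer_square:
  assumes x: "x \<in> carrier_vec n"
  shows "sparsity_map k (outer_square (vCons t x)) = mat (Suc n) (Suc n)
    (\<lambda>(i, j). if i = 0 \<and> j = 0 then of_nat k * t\<^sup>2
              else if i = 0 \<or> j = 0 \<or> i = j then vCons t x $ i * vCons t x $ j else 0)"
proof -
  have "outer_square (vCons t x) \<in> carrier_mat (Suc n) (Suc n)"
    using outer_square_carrier[of "vCons t x"] x by simp
  moreover have "outer_square (vCons t x) $$ (i, j) = vCons t x $ i * vCons t x $ j"
    if "i < Suc n" "j < Suc n" for i j
    using outer_square_index[of i "vCons t x" j] that x by simp
  ultimately show ?thesis
    by (auto simp: sparsity_map_def split_block_def Diag_def mat_diag_def power2_eq_square Let_def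
        intro!: eq_matI)
qed

lemma quadratic_form_sparsity_map:
  fixes x w :: "real vec"
  assumes x: "x \<in> carrier_vec n" and w: "w \<in> carrier_vec n"
  shows "vCons s w \<bullet> (sparsity_map k (outer_square (vCons t x)) *\<^sub>v vCons s w) =
    of_nat k * (t * s)\<^sup>2 + (\<Sum>i<n. 2 * (t * s) * (x $ i * w $ i) + (x $ i * w $ i)\<^sup>2)"
proof -
  \<comment> \<open>This is the contribution of row i + 1: the entry in column 0 gives the cross
    term, and of the remaining entries only the diagonal one survives.\<close>
  have "w $ i * (x $ i * t * s + (\<Sum>j = 0..<n. (if i = j then x $ i * x $ j else 0) * w $ j))
      = t * s * (x $ i * w $ i) + (x $ i * w $ i)\<^sup>2" if "i < n" for i
  proof -
    have "(\<Sum>j = 0..<n. (if i = j then x $ i * x $ j else 0) * w $ j)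
        = (\<Sum>j = 0..<n. if i = j then x $ i * x $ i * w $ i else 0)"
      by (intro sum.cong) auto
    then show ?thesis
      using that by (simp add: algebra_simps power2_eq_square)
  qed
  \<comment> \<open>The sums over \<open>Suc n\<close> indices are split at index 0, where
    \<open>vCons\<close> stores s and t. Row 0 and column 0 each yield the cross terms once, whence
    the factor 2 in the result.\<close>
  then have "vCons s w \<bullet> (sparsity_map k (outer_square (vCons t x)) *\<^sub>v vCons s w)
    = s * (of_nat k * t\<^sup>2 * s + (\<Sum>i = 0..<n. t * x $ i * w $ i))
      + (\<Sum>i = 0..<n. t * s * (x $ i * w $ i) + (x $ i * w $ i)\<^sup>2)"
    using w
    by (simp add: sparsity_map_outer_square[OF x] scalar_prod_def
        sum.atLeast0_lessThan_Suc_shift del: sum.op_ivl_Suc cong: if_cong)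
  then show ?thesis
    by (simp add: lessThan_atLeast0 sum.distrib sum_distrib_left algebra_simps power2_eq_square)
qed

lemma quadratic_form_sparsity_map_squares:
  fixes x w :: "real vec"
  assumes x: "x \<in> carrier_vec n" and w: "w \<in> carrier_vec n"
  shows "vCons s w \<bullet> (sparsity_map k (outer_square (vCons t x)) *\<^sub>v vCons s w) =
    (real k - real (zero_norm x)) * (t * s)\<^sup>2
      + (\<Sum>i | i < n \<and> x $ i \<noteq> 0. (t * s + x $ i * w $ i)\<^sup>2)"
proof -
  let ?S = "{i. i < n \<and> x $ i \<noteq> 0}"
  \<comment> \<open>Terms with \<open>x $ i = 0\<close> must go before the squares are completed:
    each completed square costs \<open>(t * s)\<^sup>2\<close>, so the total cost is then counted by
    \<open>zero_norm x\<close> instead of n.\<close>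
  have "(\<Sum>i<n. 2 * (t * s) * (x $ i * w $ i) + (x $ i * w $ i)\<^sup>2)
      = (\<Sum>i\<in>?S. 2 * (t * s) * (x $ i * w $ i) + (x $ i * w $ i)\<^sup>2)"
    by (intro sum.mono_neutral_right) auto
  also have "\<dots> = (\<Sum>i\<in>?S. (t * s + x $ i * w $ i)\<^sup>2 - (t * s)\<^sup>2)"
    by (intro sum.cong) (auto simp: power2_eq_square algebra_simps)
  also have "\<dots> = (\<Sum>i\<in>?S. (t * s + x $ i * w $ i)\<^sup>2) - real (zero_norm x) * (t * s)\<^sup>2"
    using x by (simp add: sum_subtractf zero_norm_def)
  finally show ?thesis
    by (simp add: quadratic_form_sparsity_map[OF x w] left_diff_distrib)
qed

lemma pos_semidef_sparsity_map_iff: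
  assumes x: "x \<in> carrier_vec n"
  shows "pos_semidef (sparsity_map k (outer_square (vCons t x))) \<longleftrightarrow> t = 0 \<or> zero_norm x \<le> k"
proof
  let ?D = "sparsity_map k (outer_square (vCons t x))"
  \<comment> \<open>Symmetry is part of \<open>pos_semidef\<close> and does not follow from the sign
    of the quadratic form, so the converse direction needs it separately.\<close>
  have dim: "dim_row ?D = Suc n" and sym: "?D \<in> sym_mats (Suc n)"
    by (auto simp: sparsity_map_outer_square[OF x] sym_mats_def mult.commute intro!: eq_matI)
  {
    assume psd: "pos_semidef ?D"
    \<comment> \<open>Paired with s = 1. Off the support the division by zero yields 0, which is
      harmless because the sum of squares ranges over the support only.\<close>
    define w where "w = vec n (\<lambda>i. - t / x $ i)"
    have w: "w \<in> carrier_vec n"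
      by (simp add: w_def)
    have "0 \<le> vCons 1 w \<bullet> (?D *\<^sub>v vCons 1 w)"
      using psd w by (simp add: pos_semidef_def dim)
    also have "\<dots> = (real k - real (zero_norm x)) * t\<^sup>2"
      unfolding quadratic_form_sparsity_map_squares[OF x w] by (simp add: w_def)
    finally show "t = 0 \<or> zero_norm x \<le> k"
      by (auto simp: zero_le_mult_iff)
  }
  assume *: "t = 0 \<or> zero_norm x \<le> k"
  have "0 \<le> v \<bullet> (?D *\<^sub>v v)" if v: "v \<in> carrier_vec (Suc n)" for v
  proof -
    obtain s w where "v = vCons s w" and w: "w \<in> carrier_vec n"
      using v by (cases v) auto
    \<comment> \<open>If t = 0 the first summand vanishes; otherwise its coefficient k - m is
      nonnegative.\<close>
    then show ?thesis
      using * by (auto simp: quadratic_form_sparsity_map_squares[OF x w]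
          intro!: add_nonneg_nonneg sum_nonneg)
  qed
  then show "pos_semidef ?D"
    using sym by (simp add: pos_semidef_def dim)
qed

theorem theorem1:
  fixes n k :: nat
  assumes "0 < k" and "k < n"
  shows "(\<forall>t. \<forall>x \<in> carrier_vec n.
            outer_square (vCons t x) \<in> sparsity_cone n k \<longleftrightarrow> t = 0 \<or> zero_norm x \<le> k) \<and>
         (\<forall>x \<in> carrier_vec n.
            outer_square (vCons 1 x) \<in> sparsity_cone n k \<longleftrightarrow> zero_norm x \<le> k)"
proof -
  have "outer_square (vCons t x) \<in> sparsity_cone n k \<longleftrightarrow> t = 0 \<or> zero_norm x \<le> k"
    if "x \<in> carrier_vec n" for t x
    using outer_square_sym[of "vCons t x"] that
    by (simp add: sparsity_cone_def pos_semidef_sparsity_map_iff)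
  then show ?thesis
    by simp
qed

end
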